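(* Let $\phi:\mathcal{H}\to\mathbb{C}$ be a nonzero Lie algebra homomorphism and let $V$ be a quasi-Whittaker module of type $\phi$ for $\mathfrak{S}$ with cyclic quasi-Whittaker vector $w$. Then the set of quasi-Whittaker vectors of type $\phi$ in $V$ is $\mathbb{C}[C_0]w\setminus\{0\}$, i.e. a nonzero vector $v\in V$ is a quasi-Whittaker vector of type $\phi$ if and only if $v\in\mathbb{C}[C_0]w$.
   Context: The Schrödinger algebra $\mathfrak{S}$ is the complex Lie algebra with basis $e,h,f,p,q,z$ and brackets $[h,e]=2e$, $[h,f]=-2f$, $[e,f]=h$, $[h,p]=p$, $[h,q]=-q$, $[p,q]=z$, $[e,q]=p$, $[p,f]=-q$, $[f,q]=0$, $[e,p]=0$, $[z,\mathfrak{S}]=0$. Its Heisenberg subalgebra is $\mathcal{H}=\mathrm{span}_{\mathbb{C}}\{p,q,z\}$. For a Lie algebra homomorphism $\phi:\mathcal{H}\to\mathbb{C}$ (so $\phi(z)=0$) and an $\mathfrak{S}$-module $V$, a nonzero vector $v\in V$ is a quasi-Whittaker vector of type $\phi$ if $xv=\phi(x)v$ for all $x\in\mathcal{H}$. $V$ is a quasi-Whittaker module of type $\phi$ if it contains a cyclic quasi-Whittaker vector $v$ of type $\phi$, i.e. one with $V=\mathcal{U}(\mathfrak{S})v$. Put $C_0=p^2f-q^2e-hpq\in\mathcal{U}(\mathfrak{S})$; $\mathbb{C}[C_0]$ is the subalgebra of $\mathcal{U}(\mathfrak{S})$ generated by $C_0$. *)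

theory Defs
  imports "HOL-Analysis.Analysis" "HOL-Library.Poly_Mapping"
begin

section \<open>The Schroedinger algebra\<close>

datatype sgen = E | H | F | P | Q | Z

lemma UNIV_sgen: "UNIV = {E, H, F, P, Q, Z}"
proof -
  have "g \<in> {E, H, F, P, Q, Z}" for g
    by (cases g) simp_all
  then show ?thesis by blast
qed

instance sgen :: finite
  by standard (simp add: UNIV_sgen)

type_synonym schroedinger = "complex ^ sgen"

abbreviation basis :: "sgen \<Rightarrow> schroedinger" where
  "basis g \<equiv> axis g 1"

text \<open>Each unordered pair of generators with nonzero bracket is listed in one order only;
  \<open>bracket\<close> is the antisymmetric bilinear extension.\<close>

fun bracket_table :: "sgen \<Rightarrow> sgen \<Rightarrow> schroedinger" where
  "bracket_table H E = 2 *s basis E"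
| "bracket_table H F = - 2 *s basis F"
| "bracket_table E F = basis H"
| "bracket_table H P = basis P"
| "bracket_table H Q = - basis Q"
| "bracket_table P Q = basis Z"
| "bracket_table E Q = basis P"
| "bracket_table P F = - basis Q"
| "bracket_table _ _ = 0"

definition bracket :: "schroedinger \<Rightarrow> schroedinger \<Rightarrow> schroedinger" where
  "bracket x y =
     (\<Sum>a\<in>UNIV. \<Sum>b\<in>UNIV. (x $ a * y $ b) *s (bracket_table a b - bracket_table b a))"

lemma all_sgen: "(\<forall>g. R g) \<longleftrightarrow> R E \<and> R H \<and> R F \<and> R P \<and> R Q \<and> R Z"
  by (metis sgen.exhaust)

lemmas bracket_components =
  vec_eq_iff bracket_def UNIV_sgen all_sgen axis_def

lemma bracket_basis:
  "bracket (basis H) (basis E) = 2 *s basis E"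
  "bracket (basis H) (basis F) = - 2 *s basis F"
  "bracket (basis E) (basis F) = basis H"
  "bracket (basis H) (basis P) = basis P"
  "bracket (basis H) (basis Q) = - basis Q"
  "bracket (basis P) (basis Q) = basis Z"
  "bracket (basis E) (basis Q) = basis P"
  "bracket (basis P) (basis F) = - basis Q"
  "bracket (basis F) (basis Q) = 0"
  "bracket (basis E) (basis P) = 0"
  by (simp_all add: bracket_components)

lemma bracket_central: "bracket (basis Z) x = 0"
  by (simp add: bracket_components)

lemma bracket_nth:
  "bracket x y $ E = 2 * (x $ H * y $ E - x $ E * y $ H)"
  "bracket x y $ H = x $ E * y $ F - x $ F * y $ E"
  "bracket x y $ F = - 2 * (x $ H * y $ F - x $ F * y $ H)"
  "bracket x y $ P = (x $ H * y $ P - x $ P * y $ H) + (x $ E * y $ Q - x $ Q * y $ E)"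
  "bracket x y $ Q = - (x $ H * y $ Q - x $ Q * y $ H) - (x $ P * y $ F - x $ F * y $ P)"
  "bracket x y $ Z = x $ P * y $ Q - x $ Q * y $ P"
  by (simp_all add: bracket_def UNIV_sgen axis_def)

lemma bracket_add_left: "bracket (x + y) u = bracket x u + bracket y u"
  by (simp add: vec_eq_iff all_sgen bracket_nth algebra_simps)

lemma bracket_scale_left: "bracket (c *s x) u = c *s bracket x u"
  by (simp add: vec_eq_iff all_sgen bracket_nth algebra_simps)

lemma bracket_self: "bracket x x = 0"
  by (simp add: vec_eq_iff all_sgen bracket_nth)

lemma bracket_antisym: "bracket x y = - bracket y x"
  by (simp add: vec_eq_iff all_sgen bracket_nth)

lemma bracket_jacobi:
  "bracket x (bracket y u) + bracket y (bracket u x) + bracket u (bracket x y) = 0"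
  by (simp add: vec_eq_iff all_sgen bracket_nth algebra_simps)

definition heisenberg :: "schroedinger set" where
  "heisenberg = vec.span {basis P, basis Q, basis Z}"

text \<open>A Lie algebra homomorphism from the Heisenberg subalgebra to the abelian Lie algebra of
  complex numbers; the values of \<open>\<phi>\<close> outside \<open>heisenberg\<close> are irrelevant.\<close>

definition heisenberg_hom :: "(schroedinger \<Rightarrow> complex) \<Rightarrow> bool" where
  "heisenberg_hom \<phi> \<longleftrightarrow>
     (\<forall>x\<in>heisenberg. \<forall>y\<in>heisenberg. \<phi> (x + y) = \<phi> x + \<phi> y) \<and>
     (\<forall>c. \<forall>x\<in>heisenberg. \<phi> (c *s x) = c * \<phi> x) \<and>
     (\<forall>x\<in>heisenberg. \<forall>y\<in>heisenberg. \<phi> (bracket x y) = \<phi> x * \<phi> y - \<phi> y * \<phi> x)"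


section \<open>The universal enveloping algebra\<close>

text \<open>The tensor algebra of the Schroedinger algebra is realised as the free associative algebra
  on the six basis elements: finitely supported functions on words, with convolution.\<close>

datatype sword = Word (letters: "sgen list")

instantiation sword :: monoid_add
begin

definition "0 = Word []"
definition "u + v = Word (letters u @ letters v)"

instance
  by standard (simp_all add: zero_sword_def plus_sword_def)

end

type_synonym tensor = "sword \<Rightarrow>\<^sub>0 complex"

definition tensor_of :: "schroedinger \<Rightarrow> tensor" where
  "tensor_of x = (\<Sum>g\<in>UNIV. Poly_Mapping.single (Word [g]) (x $ g))"

text \<open>The two-sided ideal generated by all \<open>x y - y x - [x, y]\<close>.\<close>

inductive_set envelope_ideal :: "tensor set" where
  zero: "0 \<in> envelope_ideal"
| gen: "tensor_of x * tensor_of y - tensor_of y * tensor_of x - tensor_of (bracket x y)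
          \<in> envelope_ideal"
| add: "\<lbrakk>s \<in> envelope_ideal; t \<in> envelope_ideal\<rbrakk> \<Longrightarrow> s + t \<in> envelope_ideal"
| mult_left: "t \<in> envelope_ideal \<Longrightarrow> s * t \<in> envelope_ideal"
| mult_right: "t \<in> envelope_ideal \<Longrightarrow> t * s \<in> envelope_ideal"

lemma envelope_ideal_uminus: "t \<in> envelope_ideal \<Longrightarrow> - t \<in> envelope_ideal"
  using envelope_ideal.mult_left[of t "- 1"] by simp

lemma envelope_ideal_diff:
  "\<lbrakk>s \<in> envelope_ideal; t \<in> envelope_ideal\<rbrakk> \<Longrightarrow> s - t \<in> envelope_ideal"
  using envelope_ideal.add[of s "- t"] envelope_ideal_uminus by simp

quotient_type envelope = tensor / "\<lambda>s t. s - t \<in> envelope_ideal"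
  morphisms rep_envelope envelope_class
proof (rule equivpI)
  show "reflp (\<lambda>s t. s - t \<in> envelope_ideal)"
    by (simp add: reflp_def envelope_ideal.zero)
  show "symp (\<lambda>s t. s - t \<in> envelope_ideal)"
    by (metis (mono_tags, lifting) envelope_ideal_uminus minus_diff_eq sympI)
  show "transp (\<lambda>s t. s - t \<in> envelope_ideal)"
  proof (rule transpI)
    fix r s t :: tensor
    assume "r - s \<in> envelope_ideal" "s - t \<in> envelope_ideal"
    from envelope_ideal.add[OF this] show "r - t \<in> envelope_ideal" by simp
  qed
qed

section \<open>Modules\<close>

locale schroedinger_module = vector_space smul
  for smul :: "complex \<Rightarrow> 'v::ab_group_add \<Rightarrow> 'v" +
  fixes act :: "schroedinger \<Rightarrow> 'v \<Rightarrow> 'v"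
  assumes act_add_left: "act (x + y) v = act x v + act y v"
    and act_scale_left: "act (c *s x) v = smul c (act x v)"
    and act_add_right: "act x (v + u) = act x v + act x u"
    and act_scale_right: "act x (smul c v) = smul c (act x v)"
    and act_bracket: "act (bracket x y) v = act x (act y v) - act y (act x v)"

definition word_act :: "(schroedinger \<Rightarrow> 'v \<Rightarrow> 'v) \<Rightarrow> sword \<Rightarrow> 'v \<Rightarrow> 'v" where
  "word_act act u = foldr (\<lambda>g. act (basis g)) (letters u)"

definition tensor_act ::
  "(complex \<Rightarrow> 'v \<Rightarrow> 'v) \<Rightarrow> (schroedinger \<Rightarrow> 'v \<Rightarrow> 'v) \<Rightarrow> tensor \<Rightarrow> 'v::ab_group_add \<Rightarrow> 'v" where
  "tensor_act smul act t v =
     (\<Sum>u\<in>Poly_Mapping.keys t. smul (Poly_Mapping.lookup t u) (word_act act u v))"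

context schroedinger_module
begin

lemma act_zero_right [simp]: "act x 0 = 0"
  using act_scale_right[of x 0 0] by simp

lemma act_zero_left [simp]: "act 0 v = 0"
  using act_scale_left[of 0 0 v] by simp

lemma act_sum_left: "act (sum f A) v = (\<Sum>a\<in>A. act (f a) v)"
  by (induction A rule: infinite_finite_induct) (auto simp: act_add_left)

lemma word_act_zero: "word_act act 0 v = v"
  by (simp add: word_act_def zero_sword_def)

lemma word_act_add: "word_act act (u + w) v = word_act act u (word_act act w v)"
  by (simp add: word_act_def plus_sword_def)

lemma word_act_add_right: "word_act act u (v + v') = word_act act u v + word_act act u v'"
proof -
  have "foldr (\<lambda>g. act (basis g)) gs (v + v')
      = foldr (\<lambda>g. act (basis g)) gs v + foldr (\<lambda>g. act (basis g)) gs v'" for gs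
    by (induction gs) (auto simp: act_add_right)
  then show ?thesis by (simp add: word_act_def)
qed

lemma word_act_scale: "word_act act u (smul c v) = smul c (word_act act u v)"
proof -
  have "foldr (\<lambda>g. act (basis g)) gs (smul c v)
      = smul c (foldr (\<lambda>g. act (basis g)) gs v)" for gs
    by (induction gs) (auto simp: act_scale_right)
  then show ?thesis by (simp add: word_act_def)
qed

lemma tensor_act_superset:
  assumes "finite A" "Poly_Mapping.keys t \<subseteq> A"
  shows "tensor_act smul act t v =
    (\<Sum>u\<in>A. smul (Poly_Mapping.lookup t u) (word_act act u v))"
  unfolding tensor_act_def
  by (rule sum.mono_neutral_left) (use assms in \<open>auto simp: in_keys_iff\<close>)

lemma tensor_act_zero [simp]: "tensor_act smul act 0 v = 0"
  by (simp add: tensor_act_def)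

lemma tensor_act_single:
  "tensor_act smul act (Poly_Mapping.single u c) v = smul c (word_act act u v)"
  by (simp add: tensor_act_def)

lemma tensor_act_add:
  "tensor_act smul act (s + t) v = tensor_act smul act s v + tensor_act smul act t v"
proof -
  let ?A = "Poly_Mapping.keys s \<union> Poly_Mapping.keys t"
  have "Poly_Mapping.keys (s + t) \<subseteq> ?A" by (rule keys_add)
  then show ?thesis
    by (simp add: tensor_act_superset[of ?A] lookup_add scale_left_distrib sum.distrib)
qed

lemma tensor_act_uminus: "tensor_act smul act (- t) v = - tensor_act smul act t v"
  using tensor_act_add[of t "- t" v] by (simp add: eq_neg_iff_add_eq_0 add.commute)

lemma tensor_act_diff:
  "tensor_act smul act (s - t) v = tensor_act smul act s v - tensor_act smul act t v"
  using tensor_act_add[of s "- t" v] tensor_act_uminus[of t v] by simp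

lemma tensor_act_sum:
  "tensor_act smul act (sum f A) v = (\<Sum>a\<in>A. tensor_act smul act (f a) v)"
  by (induction A rule: infinite_finite_induct) (auto simp: tensor_act_add)

lemma tensor_act_add_right:
  "tensor_act smul act t (v + v') = tensor_act smul act t v + tensor_act smul act t v'"
  by (simp add: tensor_act_def word_act_add_right scale_right_distrib sum.distrib)

lemma tensor_act_scale_right:
  "tensor_act smul act t (smul c v) = smul c (tensor_act smul act t v)"
  by (simp add: tensor_act_def word_act_scale scale_sum_right mult.commute)

lemma tensor_act_zero_right [simp]: "tensor_act smul act t 0 = 0"
  using tensor_act_scale_right[of t 0 0] by simp

lemma tensor_as_sum:
  "t = (\<Sum>u\<in>Poly_Mapping.keys t. Poly_Mapping.single u (Poly_Mapping.lookup t u))"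
  for t :: tensor
  by (rule poly_mapping_eqI)
    (auto simp: lookup_sum lookup_single when_def in_keys_iff)

lemma tensor_act_mult:
  "tensor_act smul act (s * t) v = tensor_act smul act s (tensor_act smul act t v)"
proof -
  have 1: "tensor_act smul act (Poly_Mapping.single u c * Poly_Mapping.single w d) v =
      tensor_act smul act (Poly_Mapping.single u c)
        (tensor_act smul act (Poly_Mapping.single w d) v)" for u w c d
    by (simp add: mult_single tensor_act_single word_act_add word_act_scale)
  have right_sum: "tensor_act smul act r (sum f A) = (\<Sum>a\<in>A. tensor_act smul act r (f a))"
    for r and f :: "sword \<Rightarrow> 'v" and A
    by (induction A rule: infinite_finite_induct) (auto simp: tensor_act_add_right)
  have 2: "tensor_act smul act (Poly_Mapping.single u c * t) v =
      tensor_act smul act (Poly_Mapping.single u c) (tensor_act smul act t v)" for u c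
    by (subst (1 2) tensor_as_sum[of t])
      (simp add: sum_distrib_left tensor_act_sum right_sum 1)
  show ?thesis
    by (subst (1 2) tensor_as_sum[of s])
      (simp add: sum_distrib_right tensor_act_sum 2)
qed

lemma tensor_act_one: "tensor_act smul act 1 v = v"
  using tensor_act_single[of 0 1 v] by (simp add: word_act_zero)

lemma tensor_act_of: "tensor_act smul act (tensor_of x) v = act x v"
proof -
  have x: "x = (\<Sum>g\<in>UNIV. x $ g *s basis g)"
    by (simp add: basis_expansion)
  have "tensor_act smul act (tensor_of x) v = (\<Sum>g\<in>UNIV. smul (x $ g) (act (basis g) v))"
    by (simp add: tensor_of_def tensor_act_sum tensor_act_single word_act_def)
  also have "\<dots> = act (\<Sum>g\<in>UNIV. x $ g *s basis g) v"
    by (simp add: act_sum_left act_scale_left)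
  finally show ?thesis using x by simp
qed

lemma tensor_act_ideal:
  "t \<in> envelope_ideal \<Longrightarrow> tensor_act smul act t v = 0"
  by (induction arbitrary: v rule: envelope_ideal.induct)
    (simp_all add: tensor_act_add tensor_act_diff tensor_act_mult tensor_act_of act_bracket)

end

lemma one_notin_envelope_ideal: "1 \<notin> envelope_ideal"
proof
  assume one: "1 \<in> envelope_ideal"
  have "schroedinger_module (*) (\<lambda>_ _. 0 :: complex)"
    by unfold_locales (simp_all add: distrib_left distrib_right mult.assoc)
  from schroedinger_module.tensor_act_ideal[OF this one, of 1]
    schroedinger_module.tensor_act_one[OF this, of 1]
  show False by simp
qed

instantiation envelope :: ring_1
begin

lift_definition zero_envelope :: envelope is 0 .
lift_definition one_envelope :: envelope is 1 .
lift_definition plus_envelope :: "envelope \<Rightarrow> envelope \<Rightarrow> envelope" is "(+)"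
  by (simp add: add_diff_add envelope_ideal.add)
lift_definition uminus_envelope :: "envelope \<Rightarrow> envelope" is uminus
  by (simp only: minus_diff_minus envelope_ideal_uminus)
lift_definition minus_envelope :: "envelope \<Rightarrow> envelope \<Rightarrow> envelope" is "(-)"
proof -
  fix a b c d :: tensor
  assume "a - b \<in> envelope_ideal" "c - d \<in> envelope_ideal"
  from envelope_ideal_diff[OF this] show "a - c - (b - d) \<in> envelope_ideal"
    by (simp add: algebra_simps)
qed
lift_definition times_envelope :: "envelope \<Rightarrow> envelope \<Rightarrow> envelope" is "(*)"
proof -
  fix a b c d :: tensor
  assume "a - b \<in> envelope_ideal" "c - d \<in> envelope_ideal"
  then have "(a - b) * c + b * (c - d) \<in> envelope_ideal"
    by (intro envelope_ideal.add envelope_ideal.mult_left envelope_ideal.mult_right)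
  then show "a * c - b * d \<in> envelope_ideal"
    by (simp add: algebra_simps)
qed

instance
proof
  fix a b c :: envelope
  have eqI: "s - t \<in> envelope_ideal" if "s = t" for s t :: tensor
    using that envelope_ideal.zero by simp
  show "a * b * c = a * (b * c)" by transfer (rule eqI, simp add: mult.assoc)
  show "1 * a = a" "a * 1 = a" by (transfer; rule eqI; simp)+
  show "a + b + c = a + (b + c)" by transfer (rule eqI, simp add: add.assoc)
  show "a + b = b + a" by transfer (rule eqI, simp add: add.commute)
  show "0 + a = a" "- a + a = 0" "a - b = a + - b" by (transfer; rule eqI; simp)+
  show "(a + b) * c = a * c + b * c" by transfer (rule eqI, simp add: distrib_right)
  show "a * (b + c) = a * b + a * c" by transfer (rule eqI, simp add: distrib_left)
  show "(0::envelope) \<noteq> 1"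
  proof transfer
    show "0 - 1 \<notin> envelope_ideal"
    proof
      assume "0 - 1 \<in> envelope_ideal"
      from envelope_ideal_uminus[OF this] show False
        using one_notin_envelope_ideal by (simp only: minus_diff_eq diff_zero)
    qed
  qed
qed

end

definition envelope_of :: "schroedinger \<Rightarrow> envelope" where
  "envelope_of x = envelope_class (tensor_of x)"

definition envelope_scalar :: "complex \<Rightarrow> envelope" where
  "envelope_scalar c = envelope_class (Poly_Mapping.single 0 c)"

text \<open>The value does not depend on the chosen representative; see \<open>envelope_act_class\<close> below.\<close>

definition envelope_act ::
  "(complex \<Rightarrow> 'v \<Rightarrow> 'v) \<Rightarrow> (schroedinger \<Rightarrow> 'v \<Rightarrow> 'v) \<Rightarrow> envelope \<Rightarrow> 'v::ab_group_add \<Rightarrow> 'v"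
  where
  "envelope_act smul act a v = tensor_act smul act (rep_envelope a) v"

lemma envelope_class_cases:
  obtains t where "a = envelope_class t"
  by (metis Quotient3_abs_rep[OF Quotient3_envelope])

lemma envelope_of_commutator:
  "envelope_of (bracket x y) = envelope_of x * envelope_of y - envelope_of y * envelope_of x"
proof -
  have "tensor_of (bracket x y) - (tensor_of x * tensor_of y - tensor_of y * tensor_of x)
      \<in> envelope_ideal"
    using envelope_ideal_uminus[OF envelope_ideal.gen[of x y]] by (simp add: algebra_simps)
  then show ?thesis
    by (simp add: envelope_of_def times_envelope.abs_eq minus_envelope.abs_eq
        envelope.abs_eq_iff)
qed

context schroedinger_module
begin

lemma envelope_act_class: "envelope_act smul act (envelope_class t) v = tensor_act smul act t v"
proof -
  have "rep_envelope (envelope_class t) - t \<in> envelope_ideal"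
    using Quotient3_rep_abs[OF Quotient3_envelope, of t] envelope_ideal.zero by simp
  from tensor_act_ideal[OF this, of v] show ?thesis
    by (simp add: envelope_act_def tensor_act_diff)
qed

lemma envelope_act_of: "envelope_act smul act (envelope_of x) v = act x v"
  by (simp add: envelope_of_def envelope_act_class tensor_act_of)

lemma envelope_act_scalar: "envelope_act smul act (envelope_scalar c) v = smul c v"
  by (simp add: envelope_scalar_def envelope_act_class tensor_act_single word_act_zero)

lemma envelope_act_one: "envelope_act smul act 1 v = v"
  by (simp add: one_envelope.abs_eq envelope_act_class tensor_act_one)

lemma envelope_act_add:
  "envelope_act smul act (a + b) v = envelope_act smul act a v + envelope_act smul act b v"
proof -
  obtain s t where "a = envelope_class s" "b = envelope_class t"
    using envelope_class_cases by metis
  then show ?thesis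
    by (simp add: plus_envelope.abs_eq envelope_act_class tensor_act_add)
qed

lemma envelope_act_mult:
  "envelope_act smul act (a * b) v = envelope_act smul act a (envelope_act smul act b v)"
proof -
  obtain s t where "a = envelope_class s" "b = envelope_class t"
    using envelope_class_cases by metis
  then show ?thesis
    by (simp add: times_envelope.abs_eq envelope_act_class tensor_act_mult)
qed

end

inductive_set generated_subalgebra :: "envelope set \<Rightarrow> envelope set" for X :: "envelope set" where
  scalar: "envelope_scalar c \<in> generated_subalgebra X"
| gen: "a \<in> X \<Longrightarrow> a \<in> generated_subalgebra X"
| add: "\<lbrakk>a \<in> generated_subalgebra X; b \<in> generated_subalgebra X\<rbrakk>
         \<Longrightarrow> a + b \<in> generated_subalgebra X"
| mult: "\<lbrakk>a \<in> generated_subalgebra X; b \<in> generated_subalgebra X\<rbrakk>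
         \<Longrightarrow> a * b \<in> generated_subalgebra X"

definition C0 :: envelope where
  "C0 = (let e = envelope_of (basis E); h = envelope_of (basis H); f = envelope_of (basis F);
             p = envelope_of (basis P); q = envelope_of (basis Q)
         in p\<^sup>2 * f - q\<^sup>2 * e - h * p * q)"


section \<open>Quasi-Whittaker vectors and modules\<close>

definition quasi_whittaker_vector ::
  "(complex \<Rightarrow> 'v \<Rightarrow> 'v) \<Rightarrow> (schroedinger \<Rightarrow> 'v \<Rightarrow> 'v) \<Rightarrow> (schroedinger \<Rightarrow> complex) \<Rightarrow>
    'v::ab_group_add \<Rightarrow> bool" where
  "quasi_whittaker_vector smul act \<phi> v \<longleftrightarrow>
     v \<noteq> 0 \<and> (\<forall>x\<in>heisenberg. act x v = smul (\<phi> x) v)"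

text \<open>The module with vector space \<open>'v\<close> is a quasi-Whittaker module of type \<open>\<phi>\<close> iff such a
  \<open>w\<close> exists.\<close>

definition cyclic_quasi_whittaker_vector ::
  "(complex \<Rightarrow> 'v \<Rightarrow> 'v) \<Rightarrow> (schroedinger \<Rightarrow> 'v \<Rightarrow> 'v) \<Rightarrow> (schroedinger \<Rightarrow> complex) \<Rightarrow>
    'v::ab_group_add \<Rightarrow> bool" where
  "cyclic_quasi_whittaker_vector smul act \<phi> w \<longleftrightarrow>
     quasi_whittaker_vector smul act \<phi> w \<and> (UNIV = {envelope_act smul act a w | a. True})"

end

theory Submission
  imports Defs
begin

text \<open>Since \<open>z\<close> is central and kills the cyclic vector \<open>w\<close>, it acts as zero, so \<open>p\<close> and \<open>q\<close> commute on
  the module and \<open>C0\<close> commutes with both of them. Hence every vector of \<open>N = \<complex>[C0] w\<close> satisfies the same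
  eigenvector equations as \<open>w\<close>, which is the easy inclusion.

  For the other inclusion, write \<open>\<alpha> = \<phi>(p)\<close> and \<open>\<beta> = \<phi>(q)\<close>. On a vector \<open>u\<close> with \<open>p u = \<alpha> u\<close> and
  \<open>q u = \<beta> u\<close>, the cubic element \<open>C0\<close> acts as \<open>\<alpha>\<^sup>2 f - \<beta>\<^sup>2 e - \<alpha>\<beta> h\<close>
  (\<open>C0_on_weight_vector\<close>), an element of the Lie algebra itself. An automorphism coming from \<open>SL\<^sub>2\<close> moves the
  character to one with \<open>\<alpha> \<noteq> 0\<close> and \<open>\<beta> = 0\<close>; this element is then a nonzero multiple of the new
  \<open>f\<close>, so that \<open>f\<close> preserves \<open>N\<close>. Therefore the module is the sum of the spaces \<open>e\<^sup>i K\<close>, where \<open>K\<close> is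
  the sum of the spaces \<open>x\<^sub>j N\<close> with \<open>x\<^sub>j = h (h + 1) \<dots> (h + j - 1)\<close>.

  Both layers are stripped off by operators that act like differentiation. On the outer one
  \<open>q e\<^sup>i k = - i e\<^bsup>i-1\<^esup> p k\<close> for \<open>k\<close> in \<open>K\<close>, and \<open>p\<close> is injective on \<open>K\<close>; on the inner one
  \<open>(p - \<alpha>) x\<^sub>j u = - \<alpha> j x\<^bsub>j-1\<^esub> u\<close> for \<open>u\<close> in \<open>N\<close>. As in characteristic zero for
  polynomials, the kernel of such an operator consists of the constants
  (\<open>kernel_in_base\<close>, which carries the proof and is used once for each layer). So \<open>q v = 0\<close> forces
  \<open>v \<in> K\<close>, and then \<open>p v = \<alpha> v\<close> forces \<open>v \<in> N\<close>. The module need not be free over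
  \<open>\<complex>[C0]\<close>; the argument works because the coefficients are kept as vectors of \<open>N\<close>.\<close>

section \<open>Towers and lowering operators\<close>

definition tower :: "(nat \<Rightarrow> 'v \<Rightarrow> 'v) \<Rightarrow> 'v set \<Rightarrow> 'v::ab_group_add set" where
  "tower x N = {\<Sum>i<n. x i (u i) | n u. \<forall>i. u i \<in> N}"

text \<open>The operator \<open>D\<close> plays the part of \<open>d/dx\<close>: it maps \<open>x\<^bsub>i+1\<^esub> u\<close> to \<open>x\<^sub>i (\<tau>\<^sub>i u)\<close>, where the injective map
  \<open>\<tau>\<^sub>i\<close> replaces multiplication by the nonzero integer \<open>i + 1\<close>.\<close>

locale lowering = vector_space smul
  for smul :: "complex \<Rightarrow> 'v::ab_group_add \<Rightarrow> 'v" +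
  fixes x :: "nat \<Rightarrow> 'v \<Rightarrow> 'v" and N :: "'v set" and D :: "'v \<Rightarrow> 'v" and \<tau> :: "nat \<Rightarrow> 'v \<Rightarrow> 'v"
  assumes N: "subspace N"
    and x_add: "x i (u + v) = x i u + x i v"
    and x_scale: "x i (smul c u) = smul c (x i u)"
    and x_0: "x 0 u = u"
    and D_add: "D (u + v) = D u + D v"
    and D_bottom: "u \<in> N \<Longrightarrow> D u = 0"
    and D_lowers: "u \<in> N \<Longrightarrow> D (x (Suc i) u) = x i (\<tau> i u)"
    and \<tau>_closed: "u \<in> N \<Longrightarrow> \<tau> i u \<in> N"
    and \<tau>_inj: "u \<in> N \<Longrightarrow> \<tau> i u = 0 \<Longrightarrow> u = 0"
begin

lemma x_zero [simp]: "x i 0 = 0"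
  using x_scale[of i 0 0] by simp

lemma tower_mem: "u \<in> N \<Longrightarrow> x i u \<in> tower x N"
proof -
  assume u: "u \<in> N"
  have "(\<Sum>j<Suc i. x j (if j = i then u else 0)) = x i u"
    by (simp add: if_distrib[of "x _"] cong: if_cong)
  moreover have "\<forall>j. (if j = i then u else 0) \<in> N"
    using u subspace_0[OF N] by simp
  ultimately show ?thesis unfolding tower_def
    by (intro CollectI exI[of _ "Suc i"] exI[of _ "\<lambda>j. if j = i then u else 0"]) simp
qed

lemma base_subset_tower: "N \<subseteq> tower x N"
  using tower_mem[of _ 0] by (auto simp: x_0)

text \<open>Padding with zero coefficients gives two tower elements a common length, so that they can be added.\<close>

lemma tower_pad:
  assumes "v = (\<Sum>i<n. x i (u i))" "\<forall>i. u i \<in> N" "n \<le> m"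
  shows "\<exists>u'. v = (\<Sum>i<m. x i (u' i)) \<and> (\<forall>i. u' i \<in> N)"
proof (intro exI conjI)
  show "v = (\<Sum>i<m. x i (if i < n then u i else 0))"
    unfolding assms(1) by (rule sum.mono_neutral_cong_left) (use assms(3) in auto)
  show "\<forall>i. (if i < n then u i else 0) \<in> N"
    using assms(2) subspace_0[OF N] by simp
qed

lemma tower_subspace: "subspace (tower x N)"
proof (rule subspaceI)
  show "0 \<in> tower x N"
    using tower_mem[OF subspace_0[OF N], of 0] by simp
  show "v + v' \<in> tower x N" if vs: "v \<in> tower x N" "v' \<in> tower x N" for v v'
  proof -
    obtain n u n' u' where "v = (\<Sum>i<n. x i (u i))" "\<forall>i. u i \<in> N"
        "v' = (\<Sum>i<n'. x i (u' i))" "\<forall>i. u' i \<in> N"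
      using vs unfolding tower_def by blast
    then obtain t t' where "v = (\<Sum>i<max n n'. x i (t i))" "\<forall>i. t i \<in> N"
        "v' = (\<Sum>i<max n n'. x i (t' i))" "\<forall>i. t' i \<in> N"
      using tower_pad[of v u n "max n n'"] tower_pad[of v' u' n' "max n n'"] by auto
    then show ?thesis
      unfolding tower_def
      by (intro CollectI exI[of _ "max n n'"] exI[of _ "\<lambda>i. t i + t' i"])
        (simp add: x_add sum.distrib subspace_add[OF N])
  qed
  show "smul c v \<in> tower x N" if vs: "v \<in> tower x N" for c v
  proof -
    obtain n u where "v = (\<Sum>i<n. x i (u i))" "\<forall>i. u i \<in> N"
      using vs unfolding tower_def by blast
    then show ?thesis
      unfolding tower_def
      by (intro CollectI exI[of _ n] exI[of _ "\<lambda>i. smul c (u i)"])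
        (simp add: x_scale scale_sum_right subspace_scale[OF N])
  qed
qed

lemma tower_minimal:
  assumes "subspace S" "\<And>i u. u \<in> N \<Longrightarrow> x i u \<in> S"
  shows "tower x N \<subseteq> S"
  using assms by (auto simp: tower_def intro!: subspace_sum)

lemma D_sum: "D (sum g A) = (\<Sum>a\<in>A. D (g a))"
proof (induction A rule: infinite_finite_induct)
  case (insert a A)
  then show ?case by (simp add: D_add)
qed (simp_all add: D_bottom subspace_0[OF N])

lemma D_shift:
  assumes "\<forall>i. u i \<in> N"
  shows "D (\<Sum>i<Suc n. x i (u i)) = (\<Sum>i<n. x i (\<tau> i (u (Suc i))))"
  using assms by (subst sum.lessThan_Suc_shift) (simp add: D_add D_sum x_0 D_bottom D_lowers)

text \<open>The operator \<open>D\<close> forces the layers to be independent: applied to a relation, it gives a shorter one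
  with coefficients \<open>\<tau>\<^sub>i u\<^bsub>i+1\<^esub>\<close>, so all higher coefficients vanish by induction
  and only \<open>u\<^sub>0\<close> is left.\<close>

lemma tower_independent:
  assumes "\<forall>i. u i \<in> N" "(\<Sum>i<n. x i (u i)) = 0" "i < n"
  shows "u i = 0"
  using assms
proof (induction n arbitrary: u i)
  case (Suc n)
  have "(\<Sum>i<n. x i (\<tau> i (u (Suc i)))) = 0"
    using D_shift[OF Suc.prems(1), of n] Suc.prems(2) D_bottom[OF subspace_0[OF N]] by simp
  then have "\<tau> j (u (Suc j)) = 0" if "j < n" for j
    using Suc.IH[of "\<lambda>i. \<tau> i (u (Suc i))" j] that Suc.prems(1) \<tau>_closed by simp
  then have higher: "u (Suc j) = 0" if "j < n" for j
    using \<tau>_inj Suc.prems(1) that by blast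
  then have "u 0 = 0"
    using Suc.prems(2) by (simp add: sum.lessThan_Suc_shift x_0 del: sum.lessThan_Suc)
  with higher Suc.prems(3) show ?case by (cases i) auto
qed simp

text \<open>If \<open>D v = 0\<close> then the shifted coefficients form a relation, so independence leaves only the constant term.\<close>

lemma kernel_in_base:
  assumes "v \<in> tower x N" "D v = 0"
  shows "v \<in> N"
proof -
  obtain n u where v: "v = (\<Sum>i<n. x i (u i))" and u: "\<forall>i. u i \<in> N"
    using assms(1) unfolding tower_def by blast
  show ?thesis
  proof (cases n)
    case 0
    then show ?thesis using v subspace_0[OF N] by simp
  next
    case (Suc m)
    have "(\<Sum>i<m. x i (\<tau> i (u (Suc i)))) = 0"
      using D_shift[OF u, of m] assms(2) v Suc by simp
    then have "\<tau> j (u (Suc j)) = 0" if "j < m" for j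
      using tower_independent[of "\<lambda>i. \<tau> i (u (Suc i))" m j] that u \<tau>_closed by simp
    then have "u (Suc j) = 0" if "j < m" for j
      using \<tau>_inj u that by blast
    then have "v = u 0"
      using v Suc by (simp add: sum.lessThan_Suc_shift x_0 del: sum.lessThan_Suc)
    with u show ?thesis by simp
  qed
qed

end

section \<open>Quasi-Whittaker vectors in adapted coordinates\<close>

context schroedinger_module
begin

lemma act_swap:
  "act x (act y v) = act y (act x v) + act (bracket x y) v"
  by (simp add: act_bracket)

lemma act_minus_left: "act (- x) v = - act x v"
  using act_add_left[of "- x" x v] by (simp add: eq_neg_iff_add_eq_0)

lemma act_diff_left: "act (x - y) v = act x v - act y v"
  using act_add_left[of "x - y" y v] by (simp add: eq_diff_eq)

lemma act_diff_right: "act x (v - u) = act x v - act x u"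
  using act_add_right[of x "v - u" u] by (simp add: eq_diff_eq)

lemma envelope_act_diff:
  "envelope_act smul act (a - b) v = envelope_act smul act a v - envelope_act smul act b v"
  using envelope_act_add[of "a - b" b v] by (simp add: eq_diff_eq)

lemma envelope_act_scale_right:
  "envelope_act smul act a (smul c v) = smul c (envelope_act smul act a v)"
  by (simp add: envelope_act_def tensor_act_scale_right)

lemma submodule_envelope_act:
  assumes S: "subspace S" and act: "\<And>x v. v \<in> S \<Longrightarrow> act x v \<in> S" and v: "v \<in> S"
  shows "envelope_act smul act a v \<in> S"
proof -
  have "foldr (\<lambda>g. act (basis g)) gs v \<in> S" for gs
    by (induction gs) (auto intro: act v)
  then show ?thesis
    unfolding envelope_act_def tensor_act_def word_act_def
    by (intro subspace_sum subspace_scale S)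
qed

text \<open>The rising factorial \<open>h (h + 1) \<dots> (h + j - 1)\<close>. It replaces the monomial \<open>h\<^sup>j\<close> because \<open>p h = (h - 1) p\<close>
  makes \<open>p - \<alpha>\<close> a backward difference operator in \<open>h\<close>, which lowers rising factorials without
  remainder terms.\<close>

fun rising :: "schroedinger \<Rightarrow> nat \<Rightarrow> 'v \<Rightarrow> 'v" where
  "rising h 0 u = u"
| "rising h (Suc j) u = act h (rising h j u) + smul (of_nat j) (rising h j u)"

lemma rising_add: "rising h j (u + v) = rising h j u + rising h j v"
  by (induction j) (simp_all add: act_add_right scale_right_distrib)

lemma rising_scale: "rising h j (smul c u) = smul c (rising h j u)"
  by (induction j) (simp_all add: act_scale_right scale_right_distrib mult.commute)

lemma act_power_add: "(act e ^^ i) (u + v) = (act e ^^ i) u + (act e ^^ i) v"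
  by (induction i) (simp_all add: act_add_right)

lemma act_power_scale: "(act e ^^ i) (smul c u) = smul c ((act e ^^ i) u)"
  by (induction i) (simp_all add: act_scale_right)

end

text \<open>Coordinates satisfying the bracket relations of the standard basis, chosen so that the character kills \<open>q\<close>
  and \<open>f\<close> preserves the space \<open>N\<close>, which is \<open>\<complex>[C0] w\<close> in the application.\<close>

locale adapted = schroedinger_module smul act
  for smul :: "complex \<Rightarrow> 'v::ab_group_add \<Rightarrow> 'v" and act :: "schroedinger \<Rightarrow> 'v \<Rightarrow> 'v" +
  fixes e h f p q :: schroedinger and \<alpha> :: complex and N :: "'v set"
  assumes he: "bracket h e = 2 *s e" and hf: "bracket h f = - 2 *s f" and ef: "bracket e f = h"
    and hp: "bracket h p = p" and hq: "bracket h q = - q"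
    and eq: "bracket e q = p" and ep: "bracket e p = 0"
    and spanning: "\<And>g. basis g \<in> vec.span {e, h, f, p, q, basis Z}"
    and \<alpha>: "\<alpha> \<noteq> 0"
    and N_subspace: "subspace N"
    and p_N: "u \<in> N \<Longrightarrow> act p u = smul \<alpha> u"
    and q_N: "u \<in> N \<Longrightarrow> act q u = 0"
    and f_N: "u \<in> N \<Longrightarrow> act f u \<in> N"
    and z_zero: "act (basis Z) v = 0"
begin

lemma act_he: "act h (act e v) = act e (act h v) + smul 2 (act e v)"
  by (simp add: act_swap[of h e] he act_scale_left)

lemma act_fh: "act f (act h v) = act h (act f v) + smul 2 (act f v)"
  by (simp add: act_swap[of h f] hf act_scale_left act_minus_left)

lemma act_fe: "act f (act e v) = act e (act f v) - act h v"
  by (simp add: act_swap[of e f] ef)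

lemma act_ph: "act p (act h v) = act h (act p v) - act p v"
  by (simp add: act_swap[of h p] hp)

lemma act_qh: "act q (act h v) = act h (act q v) + act q v"
  by (simp add: act_swap[of h q] hq act_minus_left)

lemma act_qe: "act q (act e v) = act e (act q v) - act p v"
  by (simp add: act_swap[of e q] eq)

lemma act_pe: "act p (act e v) = act e (act p v)"
  by (simp add: act_swap[of e p] ep)

text \<open>Equivalently \<open>(p - \<alpha>) x\<^bsub>j+1\<^esub> u = - \<alpha> (j + 1) x\<^sub>j u\<close>. The inductive step moves \<open>p\<close> past
  the last factor, \<open>p (h + j + 1) = (h + j) p\<close>.\<close>

lemma act_p_rising:
  assumes "u \<in> N"
  shows "act p (rising h (Suc j) u) =
    smul \<alpha> (rising h (Suc j) u) - smul (\<alpha> * of_nat (Suc j)) (rising h j u)"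
proof (induction j)
  case 0
  show ?case by (simp add: act_ph p_N[OF assms] act_scale_right)
next
  case (Suc j)
  let ?x = "\<lambda>j. rising h j u"
  have "act p (?x (Suc (Suc j))) =
      act h (act p (?x (Suc j))) + smul (of_nat j) (act p (?x (Suc j)))"
    by (simp only: rising.simps(2)[of h "Suc j"] act_add_right act_ph act_scale_right)
      (simp add: scale_left_distrib)
  also have "\<dots> = smul \<alpha> (act h (?x (Suc j)) + smul (of_nat j) (?x (Suc j))) -
      smul (\<alpha> * of_nat (Suc j)) (act h (?x j) + smul (of_nat j) (?x j))"
    unfolding Suc by (simp only: act_diff_right act_scale_right scale_right_distrib
        scale_right_diff_distrib scale_scale) (simp add: mult.commute algebra_simps)
  also have "act h (?x j) + smul (of_nat j) (?x j) = ?x (Suc j)"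
    by simp
  also have "smul \<alpha> (act h (?x (Suc j)) + smul (of_nat j) (?x (Suc j)))
     = smul \<alpha> (?x (Suc (Suc j))) - smul \<alpha> (?x (Suc j))"
    by (simp only: rising.simps(2)[of h "Suc j"] of_nat_Suc scale_left_distrib scale_one
        scale_right_distrib add_diff_eq) (simp add: algebra_simps)
  also have "\<dots> - smul (\<alpha> * of_nat (Suc j)) (?x (Suc j)) =
      smul \<alpha> (?x (Suc (Suc j))) - smul (\<alpha> * of_nat (Suc (Suc j))) (?x (Suc j))"
    by (simp only: of_nat_Suc distrib_left scale_left_distrib mult_1_right) simp
  finally show ?case .
qed

lemma act_q_rising: "u \<in> N \<Longrightarrow> act q (rising h j u) = 0"
  by (induction j) (simp_all add: q_N act_add_right act_qh act_scale_right)

sublocale h_tower: lowering smul "rising h" N "\<lambda>v. act p v - smul \<alpha> v"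
  "\<lambda>j. smul (- (\<alpha> * of_nat (Suc j)))"
proof unfold_locales
  show "act p (rising h (Suc i) u) - smul \<alpha> (rising h (Suc i) u)
      = rising h i (smul (- (\<alpha> * of_nat (Suc i))) u)" if "u \<in> N" for u i
    unfolding act_p_rising[OF that] rising_scale by simp
  show "u = 0" if "smul (- (\<alpha> * of_nat (Suc i))) u = 0" for u i
  proof -
    have "- (\<alpha> * of_nat (Suc i)) \<noteq> 0"
      using \<alpha> by (simp del: of_nat_Suc)
    with that show ?thesis by (simp only: scale_eq_0_iff) simp
  qed
qed (simp_all add: N_subspace rising_add rising_scale act_add_right scale_right_distrib p_N
    subspace_scale subspace_neg del: of_nat_Suc)

text \<open>The space \<open>\<complex>[h] N\<close>.\<close>

abbreviation "K \<equiv> tower (rising h) N"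

lemma K_q: "k \<in> K \<Longrightarrow> act q k = 0"
  using h_tower.tower_minimal[of "{v. act q v = 0}"] act_q_rising
  by (auto simp: subspace_def act_add_right act_scale_right)

lemma K_p:
  assumes "k \<in> K" shows "act p k \<in> K"
proof -
  have "act p (rising h i u) \<in> K" if "u \<in> N" for i u
  proof (cases i)
    case 0
    with that show ?thesis
      using h_tower.tower_mem[OF that, of 0]
      by (simp add: p_N subspace_scale[OF h_tower.tower_subspace])
  next
    case (Suc j)
    show ?thesis unfolding Suc act_p_rising[OF that]
      by (intro subspace_diff subspace_scale h_tower.tower_subspace h_tower.tower_mem that)
  qed
  then have "K \<subseteq> {v. act p v \<in> K}"
    by (intro h_tower.tower_minimal)
      (auto simp: subspace_def act_add_right act_scale_right
        intro: subspace_0 subspace_add subspace_scale h_tower.tower_subspace)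
  with assms show ?thesis by blast
qed

lemma K_h:
  assumes "k \<in> K" shows "act h k \<in> K"
proof -
  have "act h (rising h i u) \<in> K" if "u \<in> N" for i u
  proof -
    have "act h (rising h i u) = rising h (Suc i) u - smul (of_nat i) (rising h i u)"
      by simp
    also have "\<dots> \<in> K"
      by (intro subspace_diff subspace_scale h_tower.tower_subspace h_tower.tower_mem that)
    finally show ?thesis .
  qed
  then have "K \<subseteq> {v. act h v \<in> K}"
    by (intro h_tower.tower_minimal)
      (auto simp: subspace_def act_add_right act_scale_right
        intro: subspace_0 subspace_add subspace_scale h_tower.tower_subspace)
  with assms show ?thesis by blast
qed

lemma K_f:
  assumes "k \<in> K" shows "act f k \<in> K"
proof -
  have "act f (rising h i u) \<in> K" if "u \<in> N" for i u
  proof (induction i)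
    case 0
    show ?case using h_tower.tower_mem[OF f_N[OF that], of 0] by simp
  next
    case (Suc i)
    then show ?case
      by (simp add: act_add_right act_fh act_scale_right subspace_add subspace_scale
          h_tower.tower_subspace K_h)
  qed
  then have "K \<subseteq> {v. act f v \<in> K}"
    by (intro h_tower.tower_minimal)
      (auto simp: subspace_def act_add_right act_scale_right
        intro: subspace_0 subspace_add subspace_scale h_tower.tower_subspace)
  with assms show ?thesis by blast
qed

text \<open>Strip one layer with \<open>D = p - \<alpha>\<close>, which commutes with \<open>p\<close>: if \<open>p k = 0\<close> then \<open>p (D k) = 0\<close> and \<open>D k\<close> is
  shorter, so \<open>D k = 0\<close> by induction; then \<open>\<alpha> k = p k = 0\<close>.\<close>

lemma p_injective_on_K:
  assumes "k \<in> K" "act p k = 0"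
  shows "k = 0"
proof -
  have "(\<Sum>i<n. rising h i (u i)) = 0"
    if "\<forall>i. u i \<in> N" "act p (\<Sum>i<n. rising h i (u i)) = 0" for n u
    using that
  proof (induction n arbitrary: u)
    case (Suc n)
    let ?k = "\<Sum>i<Suc n. rising h i (u i)"
    let ?u = "\<lambda>i. smul (- (\<alpha> * of_nat (Suc i))) (u (Suc i))"
    have D: "act p ?k - smul \<alpha> ?k = (\<Sum>i<n. rising h i (?u i))"
      using h_tower.D_shift[OF Suc.prems(1)] .
    have "act p (act p ?k - smul \<alpha> ?k) = 0"
      using Suc.prems(2) by (simp only: act_diff_right act_scale_right) simp
    then have "act p ?k - smul \<alpha> ?k = 0"
      unfolding D using Suc.IH[of ?u] Suc.prems(1) h_tower.\<tau>_closed by blast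
    with Suc.prems(2) \<alpha> show ?case
      by (metis diff_0 neg_equal_0_iff_equal scale_eq_0_iff)
  qed simp
  with assms show ?thesis unfolding tower_def by blast
qed

lemma act_p_power: "act p ((act e ^^ i) v) = (act e ^^ i) (act p v)"
  by (induction i) (simp_all add: act_pe)

text \<open>Because \<open>[q, e] = - p\<close> commutes with \<open>e\<close>, each of the \<open>i + 1\<close> factors \<open>e\<close> contributes the same term as \<open>q\<close> is
  moved to the right, where it kills \<open>k\<close>.\<close>

lemma act_q_power:
  assumes "k \<in> K"
  shows "act q ((act e ^^ Suc i) k) = smul (- of_nat (Suc i)) ((act e ^^ i) (act p k))"
proof (induction i)
  case 0
  show ?case using K_q[OF assms] by (simp add: act_qe)
next
  case (Suc i)
  have "act q ((act e ^^ Suc (Suc i)) k) =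
      act e (act q ((act e ^^ Suc i) k)) - act p ((act e ^^ Suc i) k)"
    by (simp add: act_qe)
  also have "\<dots> = smul (- of_nat (Suc i)) ((act e ^^ Suc i) (act p k)) - (act e ^^ Suc i) (act p k)"
    by (subst Suc) (simp only: act_p_power act_scale_right, simp add: act_pe act_p_power)
  also have "\<dots> = smul (- of_nat (Suc (Suc i))) ((act e ^^ Suc i) (act p k))"
    by (simp only: of_nat_Suc[of "Suc i"] minus_add_distrib scale_left_distrib) simp
  finally show ?case .
qed

sublocale e_tower: lowering smul "\<lambda>i. act e ^^ i" K "act q"
  "\<lambda>i k. smul (- of_nat (Suc i)) (act p k)"
proof unfold_locales
  show "act q ((act e ^^ Suc i) k) = (act e ^^ i) (smul (- of_nat (Suc i)) (act p k))"
    if "k \<in> K" for k i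
    using act_q_power[OF that] by (simp only: act_power_scale)
  show "k = 0" if "k \<in> K" "smul (- of_nat (Suc i)) (act p k) = 0" for k i
  proof -
    have "(- of_nat (Suc i) :: complex) \<noteq> 0"
      by (simp del: of_nat_Suc)
    with that(2) have "act p k = 0" by (simp only: scale_eq_0_iff) simp
    with that(1) show ?thesis by (rule p_injective_on_K)
  qed
qed (simp_all add: h_tower.tower_subspace act_power_add act_power_scale act_add_right K_q K_p
    subspace_scale subspace_neg del: of_nat_Suc)

text \<open>The space \<open>\<complex>[e] \<complex>[h] N\<close>. It turns out to be a submodule: closure under \<open>e\<close>, \<open>h\<close>, \<open>p\<close> and \<open>q\<close> is
  a matter of reordering, since \<open>p\<close> and \<open>q\<close> act on \<open>N\<close> by scalars, and closure under \<open>f\<close> rests on \<open>f\<close> preserving \<open>N\<close>.\<close>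

abbreviation "M \<equiv> tower (\<lambda>i. act e ^^ i) K"

lemma M_closedI:
  assumes "\<And>i k. k \<in> K \<Longrightarrow> act y ((act e ^^ i) k) \<in> M" "v \<in> M"
  shows "act y v \<in> M"
proof -
  have "M \<subseteq> {v. act y v \<in> M}"
    using assms(1) by (intro e_tower.tower_minimal)
      (auto simp: subspace_def act_add_right act_scale_right
        intro: subspace_0 subspace_add subspace_scale e_tower.tower_subspace)
  with assms(2) show ?thesis by blast
qed

lemma M_e: "v \<in> M \<Longrightarrow> act e v \<in> M"
proof (rule M_closedI)
  show "act e ((act e ^^ i) k) \<in> M" if "k \<in> K" for i k
    using e_tower.tower_mem[OF that, of "Suc i"] by simp
qed

lemma M_h: "v \<in> M \<Longrightarrow> act h v \<in> M"
proof (rule M_closedI)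
  fix i k assume "k \<in> K"
  then show "act h ((act e ^^ i) k) \<in> M"
  proof (induction i)
    case 0
    then show ?case using e_tower.tower_mem[OF K_h[OF 0], of 0] by simp
  next
    case (Suc i)
    then show ?case
      using e_tower.tower_mem[of k "Suc i"]
      by (simp add: act_he M_e subspace_add subspace_scale e_tower.tower_subspace)
  qed
qed

lemma M_f: "v \<in> M \<Longrightarrow> act f v \<in> M"
proof (rule M_closedI)
  fix i k assume "k \<in> K"
  then show "act f ((act e ^^ i) k) \<in> M"
  proof (induction i)
    case 0
    then show ?case using e_tower.tower_mem[OF K_f[OF 0], of 0] by simp
  next
    case (Suc i)
    then show ?case
      using e_tower.tower_mem[of k i]
      by (simp add: act_fe M_e M_h subspace_diff e_tower.tower_subspace)
  qed
qed

lemma M_p: "v \<in> M \<Longrightarrow> act p v \<in> M"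
  by (rule M_closedI) (simp_all add: act_p_power e_tower.tower_mem K_p)

lemma M_q: "v \<in> M \<Longrightarrow> act q v \<in> M"
proof (rule M_closedI)
  fix i k assume k: "k \<in> K"
  show "act q ((act e ^^ i) k) \<in> M"
  proof (cases i)
    case 0
    then show ?thesis using k by (simp add: K_q subspace_0 e_tower.tower_subspace)
  next
    case (Suc j)
    show ?thesis unfolding Suc act_q_power[OF k]
      by (intro subspace_scale e_tower.tower_subspace e_tower.tower_mem K_p k)
  qed
qed

lemma M_submodule:
  assumes "v \<in> M"
  shows "act y v \<in> M"
proof -
  let ?T = "{y. act y v \<in> M}"
  have T: "vec.subspace ?T"
    by (auto simp: vec.subspace_def act_add_left act_scale_left
        intro: subspace_0 subspace_add subspace_scale e_tower.tower_subspace)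
  have "vec.span {e, h, f, p, q, basis Z} \<subseteq> ?T"
    using assms
    by (intro vec.span_minimal T)
      (auto simp: M_e M_h M_f M_p M_q z_zero subspace_0 e_tower.tower_subspace)
  with spanning have "basis g \<in> ?T" for g by blast
  then have "(\<Sum>g\<in>UNIV. y $ g *s basis g) \<in> ?T"
    by (intro vec.subspace_sum vec.subspace_scale T)
  then show ?thesis by (simp add: basis_expansion)
qed

text \<open>The vector \<open>v\<close> lies in the submodule \<open>M\<close>; the equation for \<open>q\<close> removes the powers of \<open>e\<close>, and the equation
  for \<open>p\<close> then removes the powers of \<open>h\<close>.\<close>

lemma weight_vector_in_N:
  assumes "w \<in> N" "v = envelope_act smul act a w" "act p v = smul \<alpha> v" "act q v = 0"
  shows "v \<in> N"
proof -
  have "w \<in> M"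
    using assms(1) h_tower.base_subset_tower e_tower.base_subset_tower by blast
  then have "v \<in> M"
    using submodule_envelope_act[OF e_tower.tower_subspace] M_submodule assms(2) by blast
  then have "v \<in> K" using assms(4) by (rule e_tower.kernel_in_base)
  then show ?thesis using assms(3) by (intro h_tower.kernel_in_base) simp_all
qed

end

section \<open>The Heisenberg character and the element \<open>C0\<close>\<close>

lemma heisenberg_expansion:
  assumes "x \<in> heisenberg"
  shows "x = x $ P *s basis P + x $ Q *s basis Q + x $ Z *s basis Z"
proof -
  have "heisenberg \<subseteq> {x. x $ E = 0 \<and> x $ H = 0 \<and> x $ F = 0}"
    unfolding heisenberg_def
    by (rule vec.span_minimal) (auto simp: vec.subspace_def axis_def)
  with assms show ?thesis
    by (auto simp: vec_eq_iff all_sgen axis_def)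
qed

lemma heisenberg_basis:
  "basis P \<in> heisenberg" "basis Q \<in> heisenberg" "basis Z \<in> heisenberg"
  by (auto simp: heisenberg_def intro: vec.span_base)

lemma heisenberg_hom_Z:
  assumes "heisenberg_hom \<phi>"
  shows "\<phi> (basis Z) = 0"
  using assms heisenberg_basis bracket_basis(6)
  unfolding heisenberg_hom_def by (metis cancel_comm_monoid_add_class.diff_cancel mult.commute)

lemma heisenberg_hom_expansion:
  assumes "heisenberg_hom \<phi>" "x \<in> heisenberg"
  shows "\<phi> x = x $ P * \<phi> (basis P) + x $ Q * \<phi> (basis Q)"
proof -
  have add: "\<phi> (y + y') = \<phi> y + \<phi> y'" if "y \<in> heisenberg" "y' \<in> heisenberg" for y y'
    using assms(1) that by (simp add: heisenberg_hom_def)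
  have scale: "\<phi> (c *s y) = c * \<phi> y" if "y \<in> heisenberg" for c y
    using assms(1) that by (simp add: heisenberg_hom_def)
  have mem: "c *s y \<in> heisenberg" if "y \<in> heisenberg" for c y
    using that by (simp add: heisenberg_def vec.span_scale)
  have sums: "y + y' \<in> heisenberg" if "y \<in> heisenberg" "y' \<in> heisenberg" for y y'
    using that by (simp add: heisenberg_def vec.span_add)
  have "\<phi> x = \<phi> (x $ P *s basis P + x $ Q *s basis Q + x $ Z *s basis Z)"
    using heisenberg_expansion[OF assms(2)] by simp
  then show ?thesis
    by (simp add: add scale mem sums heisenberg_basis heisenberg_hom_Z[OF assms(1)])
qed

context schroedinger_module
begin

lemma quasi_whittaker_vector_iff:
  assumes "heisenberg_hom \<phi>" "\<And>v. act (basis Z) v = 0"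
  shows "quasi_whittaker_vector smul act \<phi> v \<longleftrightarrow> v \<noteq> 0 \<and>
    act (basis P) v = smul (\<phi> (basis P)) v \<and> act (basis Q) v = smul (\<phi> (basis Q)) v"
proof -
  have "act x v = smul (\<phi> x) v"
    if "x \<in> heisenberg" "act (basis P) v = smul (\<phi> (basis P)) v"
      "act (basis Q) v = smul (\<phi> (basis Q)) v" for x
    by (subst heisenberg_expansion[OF that(1)])
      (simp add: act_add_left act_scale_left that assms(2) heisenberg_hom_expansion[OF assms(1)]
        scale_left_distrib)
  then show ?thesis
    unfolding quasi_whittaker_vector_def using heisenberg_basis by blast
qed

text \<open>The kernel of a central element is a submodule, and it contains the cyclic vector since \<open>\<phi>\<close> vanishes on
  the commutator \<open>z = [p, q]\<close>.\<close>

lemma centre_acts_trivially: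
  assumes "heisenberg_hom \<phi>" "cyclic_quasi_whittaker_vector smul act \<phi> w"
  shows "act (basis Z) v = 0"
proof -
  let ?S = "{v. act (basis Z) v = 0}"
  have "subspace ?S"
    by (auto simp: subspace_def act_add_right act_scale_right)
  moreover have "act x v \<in> ?S" if "v \<in> ?S" for x v
    using that by (simp add: act_swap[of "basis Z" x] bracket_central)
  moreover have "w \<in> ?S"
    using assms heisenberg_basis(3) heisenberg_hom_Z[OF assms(1)]
    by (simp add: cyclic_quasi_whittaker_vector_def quasi_whittaker_vector_def)
  moreover obtain a where "v = envelope_act smul act a w"
    using assms(2) unfolding cyclic_quasi_whittaker_vector_def by blast
  ultimately show ?thesis
    using submodule_envelope_act[of ?S w a] by blast
qed

lemma act_C0:
  "envelope_act smul act C0 v = act (basis P) (act (basis P) (act (basis F) v))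
    - act (basis Q) (act (basis Q) (act (basis E) v)) - act (basis H) (act (basis P) (act (basis Q) v))"
  by (simp add: C0_def Let_def envelope_act_diff envelope_act_mult envelope_act_of power2_eq_square)

text \<open>Rewrite rules that move \<open>p\<close> and \<open>q\<close> to the right of \<open>e\<close>, \<open>h\<close> and \<open>f\<close>. Together with \<open>p q = q p\<close> they bring
  every operator identity needed for \<open>C0\<close> to normal form.\<close>

lemma heisenberg_to_right:
  "act (basis P) (act (basis E) v) = act (basis E) (act (basis P) v)"
  "act (basis P) (act (basis H) v) = act (basis H) (act (basis P) v) - act (basis P) v"
  "act (basis P) (act (basis F) v) = act (basis F) (act (basis P) v) - act (basis Q) v"
  "act (basis Q) (act (basis E) v) = act (basis E) (act (basis Q) v) - act (basis P) v"
  "act (basis Q) (act (basis H) v) = act (basis H) (act (basis Q) v) + act (basis Q) v"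
  "act (basis Q) (act (basis F) v) = act (basis F) (act (basis Q) v)"
  using act_bracket[of "basis E" "basis P" v] act_bracket[of "basis H" "basis P" v]
    act_bracket[of "basis P" "basis F" v] act_bracket[of "basis E" "basis Q" v]
    act_bracket[of "basis H" "basis Q" v] act_bracket[of "basis F" "basis Q" v]
  by (simp_all add: bracket_basis act_minus_left algebra_simps)

context
  assumes z_zero: "\<And>v. act (basis Z) v = 0"
begin

lemma act_QP: "act (basis Q) (act (basis P) v) = act (basis P) (act (basis Q) v)"
  using act_bracket[of "basis P" "basis Q" v] z_zero by (simp add: bracket_basis)

lemma C0_commutes:
  "act (basis P) (envelope_act smul act C0 v) = envelope_act smul act C0 (act (basis P) v)"
  "act (basis Q) (envelope_act smul act C0 v) = envelope_act smul act C0 (act (basis Q) v)"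
  by (simp_all add: act_C0 heisenberg_to_right act_QP act_diff_right act_add_right)

lemma C0_polynomial_commutes:
  assumes "a \<in> generated_subalgebra {C0}" "g = P \<or> g = Q"
  shows "act (basis g) (envelope_act smul act a v) = envelope_act smul act a (act (basis g) v)"
  using assms(1)
proof (induction arbitrary: v)
  case (gen a)
  then show ?case using assms(2) C0_commutes by auto
qed (simp_all add: envelope_act_scalar act_scale_right envelope_act_add act_add_right
    envelope_act_mult)

text \<open>Moving \<open>p\<close> and \<open>q\<close> to the right produces the correction terms \<open>- 2 p q\<close> from \<open>p\<^sup>2 f\<close> and \<open>+ 2 p q\<close> from
  \<open>- q\<^sup>2 e\<close>, which cancel; then \<open>p\<close> and \<open>q\<close> become the scalars \<open>\<alpha>\<close> and \<open>\<beta>\<close>.\<close>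

lemma C0_on_weight_vector:
  assumes "act (basis P) u = smul \<alpha> u" "act (basis Q) u = smul \<beta> u"
  shows "envelope_act smul act C0 u =
    act (\<alpha>\<^sup>2 *s basis F - \<beta>\<^sup>2 *s basis E - (\<alpha> * \<beta>) *s basis H) u"
  by (simp add: act_C0 heisenberg_to_right act_QP act_diff_right act_add_right assms
      act_scale_right act_diff_left act_scale_left power2_eq_square scale_right_diff_distrib
      mult.commute)

text \<open>If \<open>\<alpha> \<noteq> 0\<close>, the automorphism \<open>exp (t ad e)\<close> with \<open>t = - \<beta> / \<alpha>\<close> sends \<open>q\<close> to
  \<open>q + t p\<close>, on which the character vanishes. If \<open>\<alpha> = 0\<close>, the Weyl group element that sends \<open>p\<close> to \<open>q\<close>
  and \<open>q\<close> to \<open>- p\<close> does the same. In both cases the image of \<open>f\<close> is, up to a nonzero factor, the element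
  by which \<open>C0\<close> acts on \<open>N\<close>.\<close>

lemma weight_vectors_in_C0_stable_subspace:
  assumes ab: "\<alpha> \<noteq> 0 \<or> \<beta> \<noteq> 0" and N: "subspace N"
    and P: "\<And>u. u \<in> N \<Longrightarrow> act (basis P) u = smul \<alpha> u"
    and Q: "\<And>u. u \<in> N \<Longrightarrow> act (basis Q) u = smul \<beta> u"
    and C0: "\<And>u. u \<in> N \<Longrightarrow> envelope_act smul act C0 u \<in> N"
    and w: "w \<in> N" and v: "v = envelope_act smul act a w"
    and vP: "act (basis P) v = smul \<alpha> v" and vQ: "act (basis Q) v = smul \<beta> v"
  shows "v \<in> N"
proof (cases "\<alpha> = 0")
  case False
  define t where "t = - \<beta> / \<alpha>"
  have t: "\<beta> = - t * \<alpha>" using False by (simp add: t_def)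
  \<comment> \<open>The images of \<open>h\<close>, \<open>f\<close> and \<open>q\<close> under \<open>exp (t ad e)\<close>, which fixes \<open>e\<close> and \<open>p\<close>.\<close>
  define h where "h = basis H - (2 * t) *s basis E"
  define f where "f = basis F + t *s basis H - t\<^sup>2 *s basis E"
  define q where "q = basis Q + t *s basis P"
  have q_kills: "act q u = 0" if "act (basis P) u = smul \<alpha> u" "act (basis Q) u = smul \<beta> u" for u
    using that by (simp add: q_def act_add_left act_scale_left t flip: scale_left_distrib)
  have "adapted smul act (basis E) h f (basis P) q \<alpha> N"
  proof unfold_locales
    show "bracket h (basis E) = 2 *s basis E" "bracket h f = - 2 *s f"
      "bracket (basis E) f = h" "bracket h (basis P) = basis P" "bracket h q = - q"
      "bracket (basis E) q = basis P" "bracket (basis E) (basis P) = 0"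
      unfolding h_def f_def q_def
      by (simp_all add: vec_eq_iff all_sgen bracket_nth axis_def power2_eq_square algebra_simps)
    let ?B = "{basis E, h, f, basis P, q, basis Z}"
    have B: "b \<in> vec.span ?B" if "b \<in> ?B" for b
      using that by (rule vec.span_base)
    have "basis H = h + (2 * t) *s basis E"
      by (simp add: h_def)
    then have H: "basis H \<in> vec.span ?B"
      using B by (metis insertCI vec.span_add vec.span_scale)
    have "basis F = f - t *s basis H + t\<^sup>2 *s basis E"
      by (simp add: f_def)
    then have F: "basis F \<in> vec.span ?B"
      using B H by (metis insertCI vec.span_add vec.span_diff vec.span_scale)
    have "basis Q = q - t *s basis P"
      by (simp add: q_def)
    then have "basis Q \<in> vec.span ?B"
      using B by (metis insertCI vec.span_diff vec.span_scale)
    with H F show "basis g \<in> vec.span ?B" for g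
      by (cases g) (auto intro: B)
    show "act f u \<in> N" if "u \<in> N" for u
    proof -
      have "\<alpha>\<^sup>2 *s f = \<alpha>\<^sup>2 *s basis F - \<beta>\<^sup>2 *s basis E - (\<alpha> * \<beta>) *s basis H"
        by (simp add: f_def t vec_eq_iff all_sgen axis_def power2_eq_square)
      then have "smul (\<alpha>\<^sup>2) (act f u) = envelope_act smul act C0 u"
        using C0_on_weight_vector[OF P[OF that] Q[OF that]] by (simp flip: act_scale_left)
      moreover have "act f u = smul (1 / \<alpha>\<^sup>2) (smul (\<alpha>\<^sup>2) (act f u))"
        using False by simp
      ultimately show ?thesis using subspace_scale[OF N C0[OF that]] by metis
    qed
    show "act q u = 0" if "u \<in> N" for u
      using q_kills P Q that by blast
  qed (fact False N P z_zero)+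
  then show ?thesis
    using w v vP q_kills[OF vP vQ] by (rule adapted.weight_vector_in_N)
next
  case True
  then have \<beta>: "\<beta> \<noteq> 0" using ab by simp
  \<comment> \<open>The Weyl group element sends \<open>e, h, f, p, q\<close> to \<open>-f, -h, -e, q, -p\<close>.\<close>
  have "adapted smul act (- basis F) (- basis H) (- basis E) (basis Q) (- basis P) \<beta> N"
  proof unfold_locales
    show "bracket (- basis H) (- basis F) = 2 *s (- basis F)"
      "bracket (- basis H) (- basis E) = - 2 *s (- basis E)"
      "bracket (- basis F) (- basis E) = - basis H" "bracket (- basis H) (basis Q) = basis Q"
      "bracket (- basis H) (- basis P) = - (- basis P)"
      "bracket (- basis F) (- basis P) = basis Q" "bracket (- basis F) (basis Q) = 0"
      by (simp_all add: vec_eq_iff all_sgen bracket_nth axis_def)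
    let ?B = "{- basis F, - basis H, - basis E, basis Q, - basis P, basis Z}"
    have B: "- b \<in> vec.span ?B" if "b \<in> ?B" for b
      using that by (intro vec.span_neg vec.span_base)
    show "basis g \<in> vec.span ?B" for g
      using B[of "- basis E"] B[of "- basis H"] B[of "- basis F"] B[of "- basis P"]
      by (cases g) (auto intro: vec.span_base)
    show "act (- basis E) u \<in> N" if "u \<in> N" for u
    proof -
      have "smul (\<beta>\<^sup>2) (act (- basis E) u) = envelope_act smul act C0 u"
        using C0_on_weight_vector[OF P[OF that] Q[OF that]] True
        by (simp add: act_diff_left act_scale_left act_minus_left)
      moreover have "act (- basis E) u = smul (1 / \<beta>\<^sup>2) (smul (\<beta>\<^sup>2) (act (- basis E) u))"
        using \<beta> by simp
      ultimately show ?thesis using subspace_scale[OF N C0[OF that]] by metis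
    qed
    show "act (- basis P) u = 0" if "u \<in> N" for u
      using P[OF that] True by (simp add: act_minus_left)
  qed (fact \<beta> N Q z_zero)+
  moreover have "act (- basis P) v = 0"
    using vP True by (simp add: act_minus_left)
  ultimately show ?thesis
    using w v vQ by (metis adapted.weight_vector_in_N)
qed

end

lemma subspace_subalgebra_orbit:
  "subspace {envelope_act smul act a w | a. a \<in> generated_subalgebra X}" (is "subspace ?N")
proof (rule subspaceI)
  show "0 \<in> ?N"
    using generated_subalgebra.scalar[of 0 X] envelope_act_scalar[of 0 w] by force
  show "u + v \<in> ?N" if "u \<in> ?N" "v \<in> ?N" for u v
    using that generated_subalgebra.add by (fastforce simp flip: envelope_act_add)
  show "smul c u \<in> ?N" if "u \<in> ?N" for c u
    using that generated_subalgebra.mult[OF generated_subalgebra.scalar]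
    by (fastforce simp flip: envelope_act_scalar envelope_act_mult)
qed

end

theorem theorem5p6:
  fixes smul :: "complex \<Rightarrow> 'v::ab_group_add \<Rightarrow> 'v"
    and act :: "schroedinger \<Rightarrow> 'v \<Rightarrow> 'v"
    and \<phi> :: "schroedinger \<Rightarrow> complex"
    and w :: 'v
  assumes "schroedinger_module smul act"
    and "heisenberg_hom \<phi>"
    and "\<exists>x\<in>heisenberg. \<phi> x \<noteq> 0"
    and "cyclic_quasi_whittaker_vector smul act \<phi> w"
  shows "{v. quasi_whittaker_vector smul act \<phi> v} =
    {envelope_act smul act a w | a. a \<in> generated_subalgebra {C0}} - {0}"
proof -
  interpret schroedinger_module smul act by (rule assms(1))
  let ?\<alpha> = "\<phi> (basis P)" and ?\<beta> = "\<phi> (basis Q)"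
  let ?N = "{envelope_act smul act a w | a. a \<in> generated_subalgebra {C0}}"
  have z: "act (basis Z) v = 0" for v
    using centre_acts_trivially[OF assms(2,4)] .
  note whittaker_iff = quasi_whittaker_vector_iff[OF assms(2) z]
  have wP: "act (basis P) w = smul ?\<alpha> w" and wQ: "act (basis Q) w = smul ?\<beta> w"
    using assms(4) whittaker_iff[of w] by (auto simp: cyclic_quasi_whittaker_vector_def)
  have NP: "act (basis P) u = smul ?\<alpha> u" and NQ: "act (basis Q) u = smul ?\<beta> u" if "u \<in> ?N" for u
    using that C0_polynomial_commutes[OF z] wP wQ by (auto simp: envelope_act_scale_right)
  have wN: "w \<in> ?N"
    using generated_subalgebra.scalar[of 1 "{C0}"] envelope_act_scalar[of 1 w] by force
  have C0N: "envelope_act smul act C0 u \<in> ?N" if "u \<in> ?N" for u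
    using that generated_subalgebra.mult[OF generated_subalgebra.gen[of C0 "{C0}"]]
    by (fastforce simp flip: envelope_act_mult)
  have "?\<alpha> \<noteq> 0 \<or> ?\<beta> \<noteq> 0"
    using assms(3) heisenberg_hom_expansion[OF assms(2)] by fastforce
  from weight_vectors_in_C0_stable_subspace[OF z this subspace_subalgebra_orbit NP NQ C0N wN]
  have "v \<in> ?N" if "act (basis P) v = smul ?\<alpha> v" "act (basis Q) v = smul ?\<beta> v" for v
    using that assms(4) unfolding cyclic_quasi_whittaker_vector_def by blast
  then show ?thesis
    using whittaker_iff NP NQ by blast
qed

end
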